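(* For every regular value $Q\in\Delta_{4,2}$ of the moment map $\tilde\mu:\mathbb{C}P^5\to\Delta_{4,2}$, the level set $M_Q^7=\tilde\mu^{-1}(Q)$ is a manifold homeomorphic to $S^5\times T^2$.
   Context: Label the homogeneous coordinates $(z_0:z_1:z_2:z_3:z_4:z_5)$ of $\mathbb{C}P^5$ by the pairs $12,13,14,23,24,34$ in this order. Let $\Lambda_{ij}=e_i+e_j\in\mathbb{R}^4$ for $1\le i<j\le 4$, and $\Delta_{4,2}=\{x\in\mathbb{R}^4: 0\le x_i\le 1,\ x_1+x_2+x_3+x_4=2\}$, the convex hull of the $\Lambda_{ij}$ (an octahedron). The map is $$\tilde\mu(z)=\frac{|z_0|^2\Lambda_{12}+|z_1|^2\Lambda_{13}+|z_2|^2\Lambda_{14}+|z_3|^2\Lambda_{23}+|z_4|^2\Lambda_{24}+|z_5|^2\Lambda_{34}}{\sum_{i=0}^5|z_i|^2}.$$ It is the moment map of the $T^4$-action on $\mathbb{C}P^5$ given by $(t_1,\dots,t_4)\mapsto(t_1t_2,t_1t_3,t_1t_4,t_2t_3,t_2t_4,t_3t_4)\in T^6$ acting coordinatewise. Here $T^k=(S^1)^k$. Regular value is meant for $\tilde\mu$ as a map to the affine hyperplane $x_1+x_2+x_3+x_4=2$; equivalently, $Q\in\Delta_{4,2}$ is a regular value iff every point of $\tilde\mu^{-1}(Q)$ has stabilizer exactly the diagonal circle of $T^4$. Equivalently, $Q$ lies in one of the 8 three-dimensional chambers, i.e. in the interior of $\Delta_{4,2}$ and off the hyperplanes $x_1+x_i=1$,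 $i=2,3,4$. *)

theory Defs
  imports "HOL-Analysis.Analysis"
begin

section \<open>Complex projective space\<close>

definition proportional :: "complex ^ 'n \<Rightarrow> complex ^ 'n \<Rightarrow> bool" where
  "proportional z w \<longleftrightarrow> z \<noteq> 0 \<and> w \<noteq> 0 \<and> (\<exists>c. w = c *s z)"

lemma part_equivp_proportional:
  "part_equivp (proportional :: complex ^ 'n::finite \<Rightarrow> complex ^ 'n \<Rightarrow> bool)"
proof (rule part_equivpI)
  have "proportional (1 :: complex ^ 'n) 1"
    unfolding proportional_def by (auto intro: exI[of _ 1] simp: vec_eq_iff)
  then show "\<exists>z :: complex ^ 'n. proportional z z" ..
  show "symp (proportional :: complex ^ 'n \<Rightarrow> complex ^ 'n \<Rightarrow> bool)"
  proof (rule sympI)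
    fix z w :: "complex ^ 'n"
    assume zw: "proportional z w"
    then obtain c where c: "w = c *s z"
      unfolding proportional_def by blast
    moreover have "c \<noteq> 0"
      using zw c unfolding proportional_def by auto
    ultimately have "z = inverse c *s w"
      by (simp add: vector_smult_assoc)
    with zw show "proportional w z"
      unfolding proportional_def by blast
  qed
  show "transp (proportional :: complex ^ 'n \<Rightarrow> complex ^ 'n \<Rightarrow> bool)"
    unfolding proportional_def by (intro transpI) (metis vector_smult_assoc)
qed

text \<open>
  The type \<open>'n cproj\<close> is the complex projective space of dimension \<open>CARD('n) - 1\<close>;
  the quotient map is \<open>abs_cproj\<close>, to be used on nonzero vectors only.
\<close>

quotient_type (overloaded) 'n cproj = "complex ^ 'n::finite" / partial: proportional
  by (rule part_equivp_proportional)

instantiation cproj :: (finite) topological_space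
begin

text \<open>The quotient topology; nonzero vectors form an open subset of \<open>complex ^ 'n\<close>.\<close>

definition open_cproj :: "'a cproj set \<Rightarrow> bool" where
  "open_cproj U \<longleftrightarrow> open {z. z \<noteq> 0 \<and> abs_cproj z \<in> U}"

instance
proof
  have "{z :: complex ^ 'a. z \<noteq> 0 \<and> abs_cproj z \<in> UNIV} = - {0}"
    by auto
  then show "open (UNIV :: 'a cproj set)"
    by (simp add: open_cproj_def open_Compl)
next
  fix S T :: "'a cproj set"
  assume "open S" "open T"
  moreover have "{z. z \<noteq> 0 \<and> abs_cproj z \<in> S \<inter> T} =
      {z. z \<noteq> 0 \<and> abs_cproj z \<in> S} \<inter> {z. z \<noteq> 0 \<and> abs_cproj z \<in> T}"
    by auto
  ultimately show "open (S \<inter> T)"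
    by (simp add: open_cproj_def open_Int)
next
  fix K :: "'a cproj set set"
  assume "\<forall>S\<in>K. open S"
  moreover have "{z. z \<noteq> 0 \<and> abs_cproj z \<in> \<Union>K} =
      (\<Union>S\<in>K. {z. z \<noteq> 0 \<and> abs_cproj z \<in> S})"
    by auto
  ultimately show "open (\<Union>K)"
    by (simp add: open_cproj_def open_UN)
qed

end

section \<open>The moment map\<close>

text \<open>
  The indices 1, 2, 3, 4 are the four distinct elements of type \<open>4\<close> (where \<open>4 = 0\<close>), and
  0, ..., 5 are the six elements of type \<open>6\<close>.
\<close>

definition \<Lambda> :: "4 \<Rightarrow> 4 \<Rightarrow> real ^ 4" where
  "\<Lambda> i j = axis i 1 + axis j 1"

definition hypersimplex :: "(real ^ 4) set" where
  "hypersimplex = {x. (\<forall>i. 0 \<le> x $ i \<and> x $ i \<le> 1) \<and> (\<Sum>i\<in>UNIV. x $ i) = 2}"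

lift_definition moment_map :: "6 cproj \<Rightarrow> real ^ 4" is
  "\<lambda>z. ((cmod (z $ 0))\<^sup>2 *\<^sub>R \<Lambda> 1 2 + (cmod (z $ 1))\<^sup>2 *\<^sub>R \<Lambda> 1 3 +
       (cmod (z $ 2))\<^sup>2 *\<^sub>R \<Lambda> 1 4 + (cmod (z $ 3))\<^sup>2 *\<^sub>R \<Lambda> 2 3 +
       (cmod (z $ 4))\<^sup>2 *\<^sub>R \<Lambda> 2 4 + (cmod (z $ 5))\<^sup>2 *\<^sub>R \<Lambda> 3 4)
       /\<^sub>R (\<Sum>i\<in>UNIV. (cmod (z $ i))\<^sup>2)"
proof -
  fix z w :: "complex ^ 6"
  assume zw: "proportional z w"
  then obtain c where c: "w = c *s z"
    unfolding proportional_def by blast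
  then have c0: "c \<noteq> 0"
    using zw unfolding proportional_def by auto
  have w: "(cmod (w $ i))\<^sup>2 = (cmod c)\<^sup>2 * (cmod (z $ i))\<^sup>2" for i
    by (simp add: c norm_mult power_mult_distrib)
  show "?thesis z w"
    unfolding w sum_distrib_left[symmetric] scaleR_scaleR[symmetric] scaleR_add_right[symmetric]
    using c0 by simp
qed

text \<open>
  Regularity as a map to the affine hyperplane with coordinate sum 2, whose direction space
  consists of the vectors with coordinate sum 0. The quotient map \<open>abs_cproj\<close> is a submersion
  on nonzero vectors, so the differential of \<open>moment_map\<close> at \<open>abs_cproj z\<close> has the same range
  as that of \<open>moment_map \<circ> abs_cproj\<close> at \<open>z\<close>.
\<close>

definition regular_value_moment_map :: "real ^ 4 \<Rightarrow> bool" where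
  "regular_value_moment_map Q \<longleftrightarrow>
     (\<forall>z. z \<noteq> 0 \<and> moment_map (abs_cproj z) = Q \<longrightarrow>
        (\<exists>D. ((moment_map \<circ> abs_cproj) has_derivative D) (at z) \<and>
             range D = {v. (\<Sum>i\<in>UNIV. v $ i) = 0}))"

section \<open>Topological manifolds\<close>

definition topological_manifold :: "nat \<Rightarrow> 'a topology \<Rightarrow> bool" where
  "topological_manifold n X \<longleftrightarrow>
     Hausdorff_space X \<and> second_countable X \<and>
     (\<forall>x\<in>topspace X. \<exists>U V. openin X U \<and> x \<in> U \<and> openin (Euclidean_space n) V \<and>
        subtopology X U homeomorphic_space subtopology (Euclidean_space n) V)"

end

theory Submission
  imports Defs "HOL-Homology.Invariance_of_Domain"
begin

text \<open>
  The six vertices \<open>\<Lambda> i j\<close> of the octahedron form three antipodal pairs 12|34, 13|24 and 14|23,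
  and a point \<open>Q\<close> of the hyperplane is determined by the three numbers
  \<open>e j = Q $ 1 + Q $ partner j - 1\<close>. In these terms the level set over \<open>Q\<close> consists of the lines
  through the vectors \<open>z\<close> with \<open>\<bar>z\<^sub>v\<bar>\<^sup>2 - \<bar>z\<^sub>w\<bar>\<^sup>2 = e j * \<bar>z\<bar>\<^sup>2\<close> for each antipodal pair \<open>v | w\<close>.

  If all \<open>e j\<close> are nonzero, each pair has one coordinate that is strictly larger in modulus, hence
  nonzero on the level set; its modulus is a function of the smaller coordinate. Normalise
  \<open>\<bar>z\<bar> = 1\<close>. The smaller coordinates are then constrained only by the sum of their squared moduli,
  which is half of \<open>1 - (\<bar>e 1\<bar> + \<bar>e 2\<bar> + \<bar>e 3\<bar>)\<close>; when this is positive they range over a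
  5-sphere. The phases of the three larger coordinates are free, and rotating \<open>z\<close> so that the first
  of them is positive picks one representative of each line and leaves two phases, a 2-torus. This
  is \<open>level_set_homeomorphic_sphere_torus\<close>. The manifold structure comes from stereographic
  projection on the three spherical factors.

  Both inequalities follow from regularity (\<open>regular_value_in_open_chamber\<close>): on each wall there is
  a linear functional whose composite with the moment map is, up to a constant, a combination of
  \<open>\<bar>z\<^sub>i\<bar>\<^sup>2 / \<bar>z\<bar>\<^sup>2\<close> over coordinates that all vanish at some point of the level set. Such a
  combination has derivative zero there, so the functional would vanish on all directions of the
  hyperplane. The walls are \<open>e j = 0\<close>, where both coordinates of a pair can be made to vanish, and the
  boundary of the octahedron, where all smaller coordinates vanish.
\<close>

section \<open>Maps out of projective space\<close>

lemma proportional_refl: "z \<noteq> 0 \<Longrightarrow> proportional z z"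
  unfolding proportional_def by (metis vector_smult_lid)

lemma abs_cproj_eq_iff:
  assumes "z \<noteq> 0" "w \<noteq> 0"
  shows "abs_cproj z = abs_cproj w \<longleftrightarrow> (\<exists>c. w = c *s z)"
  using Quotient3_rel[OF Quotient3_cproj, of z w] assms proportional_refl
  by (auto simp: proportional_def)

lemma abs_cproj_smult:
  assumes "z \<noteq> 0" "c \<noteq> 0"
  shows "abs_cproj (c *s z) = abs_cproj z"
  using assms abs_cproj_eq_iff[of z "c *s z"] by auto

lemma cproj_cases:
  obtains z where "z \<noteq> 0" "p = abs_cproj z"
  by (induction p rule: cproj.abs_induct) (auto simp: proportional_def)

lemma continuous_on_abs_cproj:
  "continuous_on (- {0}) (abs_cproj :: complex ^ 'n::finite \<Rightarrow> 'n cproj)"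
proof -
  have "open (abs_cproj -` B \<inter> - {0})" if "open B" for B :: "'n cproj set"
  proof -
    have "{z. z \<noteq> 0 \<and> abs_cproj z \<in> B} = abs_cproj -` B \<inter> - {0}"
      by blast
    with that show ?thesis
      by (simp add: open_cproj_def)
  qed
  moreover have "open (- {0} :: (complex ^ 'n) set)"
    by (simp add: open_Compl)
  ultimately show ?thesis
    using continuous_on_open_vimage by blast
qed

text \<open>
  The universal property of the quotient topology, restricted to an open set: openness of \<open>V\<close>
  makes the preimage of \<open>V\<close> open, so that relative openness upstairs is openness.
\<close>

lemma continuous_on_cproj:
  assumes "open V"
    and cont: "continuous_on {z. z \<noteq> 0 \<and> abs_cproj z \<in> V} (\<lambda>z. f (abs_cproj z))"
  shows "continuous_on V f"
proof (subst continuous_on_open_vimage[OF \<open>open V\<close>], intro allI impI)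
  fix B :: "'b set"
  assume "open B"
  moreover have "open {z. z \<noteq> 0 \<and> abs_cproj z \<in> V}"
    using \<open>open V\<close> by (simp add: open_cproj_def)
  ultimately have "open ((\<lambda>z. f (abs_cproj z)) -` B \<inter> {z. z \<noteq> 0 \<and> abs_cproj z \<in> V})"
    using cont continuous_on_open_vimage by blast
  moreover have "{z. z \<noteq> 0 \<and> abs_cproj z \<in> f -` B \<inter> V}
      = (\<lambda>z. f (abs_cproj z)) -` B \<inter> {z. z \<noteq> 0 \<and> abs_cproj z \<in> V}"
    by auto
  ultimately show "open (f -` B \<inter> V)"
    by (simp add: open_cproj_def)
qed

section \<open>Level sets of paired coordinates\<close>

lemma norm_complex_vec_squared: "(norm (z :: complex ^ 'n::finite))\<^sup>2 = (\<Sum>i\<in>UNIV. (cmod (z $ i))\<^sup>2)"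
  by (simp add: norm_vec_def L2_set_def sum_nonneg)

lemma norm_axis_squared: "(norm (axis k c :: complex ^ 'n::finite))\<^sup>2 = (cmod c)\<^sup>2"
proof -
  have "(cmod ((axis k c :: complex ^ 'n) $ i))\<^sup>2 = (if i = k then (cmod c)\<^sup>2 else 0)" for i
    by (simp add: axis_def)
  then show ?thesis
    by (simp add: norm_complex_vec_squared)
qed

text \<open>
  The torus of all phases modulo simultaneous rotation, with the representative normalised at \<open>b\<close>.
\<close>

definition based_torus :: "'n \<Rightarrow> (complex ^ 'n::finite) set" where
  "based_torus b = {\<tau>. (\<forall>j. cmod (\<tau> $ j) = 1) \<and> \<tau> $ b = 1}"

text \<open>
  Splitting the coordinates into pairs \<open>(lo j, hi j)\<close> abstractly avoids a case distinction over the
  eight chambers of the octahedron: these differ only in which member of each antipodal pair of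
  vertices carries the coordinate of larger modulus, \<open>hi j\<close>, called dominant below.
\<close>

locale coordinate_pairing =
  fixes lo hi :: "'n::finite \<Rightarrow> 'm::finite"
  assumes inj_lo: "inj lo" and inj_hi: "inj hi"
    and disjoint: "\<And>i j. lo i \<noteq> hi j"
    and cover: "range lo \<union> range hi = UNIV"
begin

lemma sum_pairs: "(\<Sum>i\<in>UNIV. f i) = (\<Sum>j\<in>UNIV. f (lo j) + f (hi j) :: real)"
proof -
  have "(\<Sum>i\<in>UNIV. f i) = (\<Sum>i\<in>range lo. f i) + (\<Sum>i\<in>range hi. f i)"
    using disjoint by (subst sum.union_disjoint[symmetric]) (auto simp: cover)
  then show ?thesis
    by (simp add: sum.reindex inj_lo inj_hi sum.distrib)
qed

lemma vec_eq_pairs: "z = w \<longleftrightarrow> (\<forall>j. z $ lo j = w $ lo j \<and> z $ hi j = w $ hi j)"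
proof
  assume *: "\<forall>j. z $ lo j = w $ lo j \<and> z $ hi j = w $ hi j"
  show "z = w"
    unfolding vec_eq_iff
  proof
    fix i
    have "i \<in> range lo \<union> range hi"
      using cover by auto
    with * show "z $ i = w $ i"
      by auto
  qed
qed auto

definition level_cone :: "('n \<Rightarrow> real) \<Rightarrow> (complex ^ 'm) set" where
  "level_cone c = {z. z \<noteq> 0 \<and>
     (\<forall>j. (cmod (z $ hi j))\<^sup>2 - (cmod (z $ lo j))\<^sup>2 = c j * (norm z)\<^sup>2)}"

text \<open>
  The unit vector of the cone whose small coordinates are \<open>w\<close> and whose dominant coordinates have
  phases \<open>\<tau>\<close>; the factor in front of the phase is the modulus that the equations of the cone force.
\<close>

definition assemble :: "('n \<Rightarrow> real) \<Rightarrow> (complex ^ 'n) \<times> (complex ^ 'n) \<Rightarrow> complex ^ 'm" where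
  "assemble c = (\<lambda>(w, \<tau>). \<chi> i. if i \<in> range lo then w $ (the_inv lo i)
     else of_real (sqrt ((cmod (w $ (the_inv hi i)))\<^sup>2 + c (the_inv hi i))) * \<tau> $ (the_inv hi i))"

lemma assemble_lo [simp]: "assemble c (w, \<tau>) $ lo j = w $ j"
  by (simp add: assemble_def inj_lo the_inv_f_f)

lemma assemble_hi [simp]:
  "assemble c (w, \<tau>) $ hi j = of_real (sqrt ((cmod (w $ j))\<^sup>2 + c j)) * \<tau> $ j"
  using disjoint by (auto simp: assemble_def inj_hi the_inv_f_f) (metis disjoint)

lemma norm_assemble:
  assumes "\<And>j. 0 \<le> c j" and "\<And>j. cmod (\<tau> $ j) = 1"
  shows "(norm (assemble c (w, \<tau>)))\<^sup>2 = 2 * (norm w)\<^sup>2 + sum c UNIV"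
  using assms
  by (simp add: norm_complex_vec_squared sum_pairs norm_mult power_mult_distrib sum.distrib
      sum_distrib_left)

lemma assemble_in_level_cone:
  assumes "\<And>j. 0 \<le> c j" and "\<And>j. cmod (\<tau> $ j) = 1"
    and "2 * (norm w)\<^sup>2 + sum c UNIV = 1"
  shows "assemble c (w, \<tau>) \<in> level_cone c"
proof -
  have "(norm (assemble c (w, \<tau>)))\<^sup>2 = 1"
    using norm_assemble[of c \<tau> w] assms by simp
  moreover from this have "assemble c (w, \<tau>) \<noteq> 0"
    by auto
  ultimately show ?thesis
    using assms(1,2) by (simp add: level_cone_def norm_mult power_mult_distrib)
qed

text \<open>
  Division by \<open>norm z * sgn (z $ hi b)\<close> replaces \<open>z\<close> by the unit vector on the same line whose
  coordinate at \<open>hi b\<close> is positive, and therefore yields data that depend on the line only.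
\<close>

definition disassemble :: "'n \<Rightarrow> complex ^ 'm \<Rightarrow> (complex ^ 'n) \<times> (complex ^ 'n)" where
  "disassemble b z =
     ((\<chi> j. z $ lo j / (of_real (norm z) * sgn (z $ hi b))), (\<chi> j. sgn (z $ hi j / z $ hi b)))"

lemma disassemble_smult:
  assumes "k \<noteq> 0"
  shows "disassemble b (k *s z) = disassemble b z"
proof -
  have norm: "norm (k *s z) = cmod k * norm z"
  proof (rule power2_eq_imp_eq)
    show "(norm (k *s z))\<^sup>2 = (cmod k * norm z)\<^sup>2"
      unfolding power_mult_distrib norm_complex_vec_squared
      by (simp add: norm_mult power_mult_distrib sum_distrib_left)
  qed auto
  have k: "of_real (cmod k) * sgn k = k"
    using assms by (simp add: sgn_eq)
  have "k * z $ lo j / (of_real (cmod k * norm z) * sgn (k * z $ hi b))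
      = z $ lo j / (of_real (norm z) * sgn (z $ hi b))" for j
  proof -
    have "of_real (cmod k * norm z) * sgn (k * z $ hi b)
        = (of_real (cmod k) * sgn k) * (of_real (norm z) * sgn (z $ hi b))"
      by (simp add: sgn_mult)
    also have "\<dots> = k * (of_real (norm z) * sgn (z $ hi b))"
      unfolding k ..
    finally have eq: "of_real (cmod k * norm z) * sgn (k * z $ hi b) = k * (of_real (norm z) * sgn (z $ hi b))" .
    show ?thesis
      unfolding eq using assms by simp
  qed
  then show ?thesis
    using assms by (simp add: disassemble_def norm)
qed

lemma continuous_on_assemble: 
  assumes "\<And>j. 0 \<le> c j"
  shows "continuous_on S (assemble c)"
proof -
  have "continuous_on S (\<lambda>p. if i \<in> range lo then fst p $ (the_inv lo i)
     else of_real (sqrt ((cmod (fst p $ (the_inv hi i)))\<^sup>2 + c (the_inv hi i))) * snd p $ (the_inv hi i))" for i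
    by (cases "i \<in> range lo") (auto intro!: continuous_intros)
  then show ?thesis
    unfolding assemble_def case_prod_beta by (intro continuous_on_vec_lambda)
qed

lemma continuous_on_disassemble:
  assumes "\<And>z. z \<in> S \<Longrightarrow> \<forall>j. z $ hi j \<noteq> 0"
  shows "continuous_on S (disassemble b)"
proof -
  have "z \<noteq> 0" if "z \<in> S" for z
    using assms[OF that] by auto
  then show ?thesis
    unfolding disassemble_def using assms
    by (intro continuous_on_Pair continuous_on_vec_lambda continuous_on_divide continuous_on_mult
          continuous_on_sgn continuous_on_of_real continuous_on_norm continuous_intros)
       (auto simp: sgn_zero_iff)
qed

lemma assemble_disassemble:
  assumes z: "z \<in> level_cone c" and hi: "\<And>j. z $ hi j \<noteq> 0"
  shows "assemble c (disassemble b z) = inverse (of_real (norm z) * sgn (z $ hi b)) *s z"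
proof -
  have nz: "z \<noteq> 0"
    using z by (simp add: level_cone_def)
  have u: "cmod (sgn (z $ hi b)) = 1"
    using hi by (simp add: norm_sgn)
  have "sqrt ((cmod (z $ lo j / (of_real (norm z) * sgn (z $ hi b))))\<^sup>2 + c j) = cmod (z $ hi j) / norm z" for j
  proof -
    have "(cmod (z $ lo j / (of_real (norm z) * sgn (z $ hi b))))\<^sup>2 + c j
        = ((cmod (z $ lo j))\<^sup>2 + c j * (norm z)\<^sup>2) / (norm z)\<^sup>2"
      using nz u by (simp add: norm_divide norm_mult power_divide add_divide_distrib)
    also have "\<dots> = (cmod (z $ hi j) / norm z)\<^sup>2"
      using z by (simp add: level_cone_def power_divide algebra_simps)
    finally show ?thesis
      by simp
  qed
  note root = this
  have "of_real (cmod (z $ hi j) / norm z) * sgn (z $ hi j / z $ hi b)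
      = z $ hi j / (of_real (norm z) * sgn (z $ hi b))" for j
  proof -
    have "of_real (cmod (z $ hi j)) * sgn (z $ hi j) = z $ hi j"
      using hi by (simp add: sgn_eq)
    then have "of_real (cmod (z $ hi j) / norm z) * sgn (z $ hi j / z $ hi b)
        = z $ hi j / of_real (norm z) / sgn (z $ hi b)"
      by (simp add: sgn_divide)
    then show ?thesis
      by simp
  qed
  with root show ?thesis
    unfolding vec_eq_pairs disassemble_def
    by (simp add: field_simps)
qed

lemma disassemble_assemble:
  assumes c: "\<And>j. 0 < c j" and \<tau>: "\<tau> \<in> based_torus b"
    and w: "2 * (norm w)\<^sup>2 + sum c UNIV = 1"
  shows "disassemble b (assemble c (w, \<tau>)) = (w, \<tau>)"
proof -
  have "(norm (assemble c (w, \<tau>)))\<^sup>2 = 1"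
    using norm_assemble[of c \<tau> w] c \<tau> w by (simp add: less_imp_le based_torus_def)
  then have "norm (assemble c (w, \<tau>)) = 1"
    by (metis norm_ge_zero abs_of_nonneg real_sqrt_abs real_sqrt_one)
  moreover have pos: "0 < sqrt ((cmod (w $ j))\<^sup>2 + c j)" for j
    using c by (simp add: add_nonneg_pos)
  then have "sgn (of_real (sqrt ((cmod (w $ j))\<^sup>2 + c j)) :: complex) = 1" for j
    by (simp only: sgn_of_real sgn_pos of_real_1)
  moreover have "sgn (\<tau> $ j) = \<tau> $ j" for j
    using \<tau> by (simp add: based_torus_def sgn_eq)
  moreover have "\<tau> $ b = 1"
    using \<tau> by (simp add: based_torus_def)
  ultimately show ?thesis
    by (simp add: disassemble_def vec_eq_iff sgn_divide sgn_mult)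
qed

text \<open>
  Lines in the cone correspond to pairs of a vector of small coordinates and a tuple of phases by
  \<open>disassemble\<close> and \<open>assemble\<close>. Summing the equations of the cone shows that on it the squared
  moduli of the small coordinates add up to \<open>(1 - sum c UNIV) / 2\<close> times \<open>(norm z)\<^sup>2\<close>. Continuity
  of \<open>disassemble\<close> on lines is obtained on the open set \<open>V\<close> where no dominant coordinate
  vanishes.
\<close>

theorem level_set_homeomorphic_sphere_torus:
  fixes b :: 'n
  assumes c: "\<And>j. 0 < c j" and sum_c: "sum c UNIV < 1"
  shows "abs_cproj ` level_cone c homeomorphic
           sphere (0 :: complex ^ 'n) (sqrt ((1 - sum c UNIV) / 2)) \<times> based_torus b"
    (is "?L homeomorphic ?T")
proof -
  have c0: "0 \<le> c j" for j
    using c less_imp_le by blast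
  define V where "V = abs_cproj ` {z :: complex ^ 'm. \<forall>j. z $ hi j \<noteq> 0}"
  have V_iff: "abs_cproj z \<in> V \<longleftrightarrow> (\<forall>j. z $ hi j \<noteq> 0)" if "z \<noteq> 0" for z
  proof
    assume "abs_cproj z \<in> V"
    then obtain y where y: "\<forall>j. y $ hi j \<noteq> 0" "abs_cproj z = abs_cproj y"
      unfolding V_def by auto
    moreover from y(1) have "y \<noteq> 0"
      by auto
    ultimately show "\<forall>j. z $ hi j \<noteq> 0"
      using that abs_cproj_eq_iff[of z y] by auto
  qed (simp add: V_def)
  have V_cone: "{z. z \<noteq> 0 \<and> abs_cproj z \<in> V} = (\<Inter>j. {z. z $ hi j \<noteq> 0})"
  proof -
    have "z \<noteq> 0" if "\<forall>j. z $ hi j \<noteq> 0" for z :: "complex ^ 'm"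
      using that by auto
    then show ?thesis
      using V_iff by blast
  qed
  have "open V"
    unfolding open_cproj_def V_cone
    by (intro open_INT ballI open_Collect_neq continuous_intros) auto
  have cone_hi: "z $ hi j \<noteq> 0" if "z \<in> level_cone c" for z j
  proof
    assume "z $ hi j = 0"
    moreover have "(cmod (z $ hi j))\<^sup>2 - (cmod (z $ lo j))\<^sup>2 = c j * (norm z)\<^sup>2"
      using that by (simp add: level_cone_def)
    ultimately have "c j * (norm z)\<^sup>2 \<le> 0"
      by (simp flip: \<open>_ = c j * (norm z)\<^sup>2\<close>)
    moreover have "0 < (norm z)\<^sup>2"
      using that by (simp add: level_cone_def)
    ultimately show False
      using c[of j] by (simp add: mult_le_0_iff)
  qed
  define g where "g p = disassemble b (rep_cproj p)" for p
  have g: "g (abs_cproj z) = disassemble b z" if "z \<noteq> 0" for z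
  proof -
    have "proportional (rep_cproj (abs_cproj z)) z"
      using that proportional_refl Quotient3_cproj by (metis Quotient3_rep_abs)
    then obtain k where k: "z = k *s rep_cproj (abs_cproj z)"
      unfolding proportional_def by blast
    with that have "k \<noteq> 0"
      by (metis vector_smult_lzero)
    then have "disassemble b (k *s rep_cproj (abs_cproj z)) = g (abs_cproj z)"
      unfolding g_def by (rule disassemble_smult)
    then show ?thesis
      by (simp flip: k)
  qed
  have cont_g: "continuous_on V g"
  proof (rule continuous_on_cproj[OF \<open>open V\<close>])
    have "continuous_on {z. z \<noteq> 0 \<and> abs_cproj z \<in> V} (disassemble b)"
      by (rule continuous_on_disassemble) (use V_iff in auto)
    then show "continuous_on {z. z \<noteq> 0 \<and> abs_cproj z \<in> V} (\<lambda>z. g (abs_cproj z))"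
      by (rule continuous_on_eq) (simp add: g)
  qed
  have T: "2 * (norm w)\<^sup>2 + sum c UNIV = 1 \<and> (\<forall>j. cmod (\<tau> $ j) = 1) \<and> \<tau> \<in> based_torus b"
    if "(w, \<tau>) \<in> ?T" for w \<tau>
    using that sum_c by (auto simp: based_torus_def diff_divide_distrib)
  have cone: "assemble c p \<in> level_cone c" if "p \<in> ?T" for p
    using assemble_in_level_cone c0 T that by (cases p) blast
  have nonzero: "assemble c p \<noteq> 0" if "p \<in> ?T" for p
    using cone[OF that] by (simp add: level_cone_def)
  have "homeomorphism ?L ?T g (abs_cproj \<circ> assemble c)"
  proof (rule homeomorphismI)
    have "?L \<subseteq> V"
      using cone_hi unfolding V_def by auto
    then show "continuous_on ?L g"
      by (rule continuous_on_subset[OF cont_g])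
    have "assemble c p \<in> - {0}" if "p \<in> ?T" for p
      using nonzero[OF that] by simp
    then have "assemble c ` ?T \<subseteq> - {0}"
      by (rule image_subsetI)
    then show "continuous_on ?T (abs_cproj \<circ> assemble c)"
      by (rule continuous_on_compose[OF continuous_on_assemble[OF c0]
            continuous_on_subset[OF continuous_on_abs_cproj]])
    show "(abs_cproj \<circ> assemble c) ` ?T \<subseteq> ?L"
      using cone by (simp add: image_subset_iff)
    show "g ((abs_cproj \<circ> assemble c) p) = p" if p: "p \<in> ?T" for p
    proof -
      obtain w \<tau> where wt: "p = (w, \<tau>)"
        by (cases p)
      then have "disassemble b (assemble c p) = p"
        using T[of w \<tau>] p disassemble_assemble[of c \<tau> b w] c by blast
      then show ?thesis
        using g[OF nonzero[OF p]] by simp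
    qed
    have "g (abs_cproj z) \<in> ?T" if z: "z \<in> level_cone c" for z
    proof -
      from z have nz: "z \<noteq> 0" and eq: "\<And>j. (cmod (z $ hi j))\<^sup>2 - (cmod (z $ lo j))\<^sup>2 = c j * (norm z)\<^sup>2"
        by (auto simp: level_cone_def)
      define w where "w = fst (disassemble b z)"
      have norm_w: "(norm w)\<^sup>2 = (\<Sum>j\<in>UNIV. (cmod (z $ lo j))\<^sup>2) / (norm z)\<^sup>2"
        using cone_hi[OF z] nz
        by (simp add: w_def disassemble_def norm_complex_vec_squared[of "vec_lambda _"] norm_divide norm_mult norm_sgn
            power_divide sum_divide_distrib)
      have "(norm z)\<^sup>2 = (\<Sum>j\<in>UNIV. (cmod (z $ lo j))\<^sup>2 + (cmod (z $ hi j))\<^sup>2)"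
        by (simp add: norm_complex_vec_squared sum_pairs)
      moreover have "sum c UNIV * (norm z)\<^sup>2
          = (\<Sum>j\<in>UNIV. (cmod (z $ hi j))\<^sup>2) - (\<Sum>j\<in>UNIV. (cmod (z $ lo j))\<^sup>2)"
        by (simp add: sum_distrib_right sum_subtractf flip: eq)
      ultimately have "(norm z)\<^sup>2 = 2 * (\<Sum>j\<in>UNIV. (cmod (z $ lo j))\<^sup>2) + sum c UNIV * (norm z)\<^sup>2"
        by (simp add: sum.distrib)
      then have "(\<Sum>j\<in>UNIV. (cmod (z $ lo j))\<^sup>2) = (1 - sum c UNIV) / 2 * (norm z)\<^sup>2"
        by (simp add: algebra_simps)
      with norm_w have "(norm w)\<^sup>2 = (1 - sum c UNIV) / 2"
        using nz by simp
      then have "norm w = sqrt ((1 - sum c UNIV) / 2)"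
        by (metis norm_ge_zero real_sqrt_abs abs_of_nonneg)
      moreover have "snd (disassemble b z) \<in> based_torus b"
        using cone_hi[OF z] by (simp add: based_torus_def disassemble_def norm_divide norm_sgn sgn_zero_iff)
      ultimately show ?thesis
        using nz by (simp add: g w_def mem_Times_iff)
    qed
    then show "g ` ?L \<subseteq> ?T"
      by blast
    show "(abs_cproj \<circ> assemble c) (g p) = p" if "p \<in> ?L" for p
    proof -
      from that obtain z where z: "z \<in> level_cone c" "p = abs_cproj z"
        by auto
      then have "z \<noteq> 0"
        by (simp add: level_cone_def)
      moreover have "inverse (of_real (norm z) * sgn (z $ hi b)) \<noteq> 0"
        using cone_hi[OF z(1)] \<open>z \<noteq> 0\<close> by (simp add: sgn_zero_iff)
      ultimately show ?thesis
        using z assemble_disassemble[OF z(1) cone_hi[OF z(1)]] by (simp add: g abs_cproj_smult)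
    qed
  qed
  then show ?thesis
    unfolding homeomorphic_def by blast
qed

end


section \<open>Products of spheres are manifolds\<close>

lemma homeomorphic_product:
  assumes "S homeomorphic S'" "T homeomorphic T'"
  shows "S \<times> T homeomorphic S' \<times> T'"
proof -
  have "prod_topology (top_of_set S) (top_of_set T) homeomorphic_space
      prod_topology (top_of_set S') (top_of_set T')"
    using assms by (intro homeomorphic_space_prod_topology) simp_all
  then show ?thesis
    by (simp flip: subtopology_Times euclidean_product_topology)
qed

text \<open>Stereographic projection from the antipode \<open>- x\<close>.\<close>

lemma sphere_locally_euclidean:
  fixes x :: "'a::euclidean_space"
  assumes "DIM('a) = DIM('b::euclidean_space) + 1" "x \<in> sphere 0 1"
  obtains U where "openin (top_of_set (sphere 0 1)) U" "x \<in> U" "U homeomorphic (UNIV :: 'b set)"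
proof
  show "openin (top_of_set (sphere 0 1)) (sphere 0 1 - {- x})"
    by (simp add: openin_delete)
  show "x \<in> sphere 0 1 - {- x}"
    using assms(2) by (auto simp: eq_neg_iff_add_eq_0 simp flip: scaleR_2)
  show "sphere 0 1 - {- x} homeomorphic (UNIV :: 'b set)"
    by (rule homeomorphic_punctured_sphere_affine) (use assms in auto)
qed

lemma second_countable_euclidean: "second_countable (euclidean :: 'a::second_countable_topology topology)"
proof -
  obtain B :: "'a set set" where B: "countable B" "topological_basis B"
    using ex_countable_basis by blast
  then have "\<exists>V\<in>B. x \<in> V \<and> V \<subseteq> U" if "open U" "x \<in> U" for U x
    using topological_basisE that by metis
  with B show ?thesis
    unfolding second_countable_def by (auto simp: topological_basis_open)
qed

lemma topological_manifold_if_homeomorphic: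
  fixes T :: "'b::{metric_space, second_countable_topology} set"
  assumes homeo: "S homeomorphic T"
    and charts: "\<And>x. x \<in> T \<Longrightarrow>
      \<exists>U. openin (top_of_set T) U \<and> x \<in> U \<and> U homeomorphic (UNIV :: 'e::euclidean_space set)"
  shows "topological_manifold DIM('e) (top_of_set S)"
  unfolding topological_manifold_def
proof (intro conjI ballI)
  have homeo': "top_of_set S homeomorphic_space top_of_set T"
    unfolding homeomorphic_space_iff_homeomorphic by (rule homeo)
  show "Hausdorff_space (top_of_set S)"
    unfolding homeomorphic_Hausdorff_space[OF homeo']
    by (rule Hausdorff_space_subtopology[OF Hausdorff_space_euclidean])
  show "second_countable (top_of_set S)"
    unfolding homeomorphic_space_second_countability[OF homeo']
    by (rule second_countable_subtopology[OF second_countable_euclidean])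
  fix x
  assume "x \<in> topspace (top_of_set S)"
  then have x: "x \<in> S"
    by simp
  obtain f g where fg: "homeomorphism S T f g"
    using homeo unfolding homeomorphic_def by blast
  then have fS: "f ` S = T"
    by (rule homeomorphism_image1)
  with x have "f x \<in> T"
    by blast
  then obtain U where U: "openin (top_of_set T) U" "f x \<in> U" "U homeomorphic (UNIV :: 'e set)"
    using charts[of "f x"] by blast
  then have "U \<subseteq> T"
    by (simp add: openin_imp_subset)
  define U' where "U' = S \<inter> f -` U"
  have "openin (top_of_set S) U'"
    unfolding U'_def using fg U(1)
    by (intro continuous_openin_preimage[of S f T]) (auto simp: homeomorphism_def)
  have "x \<in> U'"
    using x U(2) by (simp add: U'_def)
  have "U' homeomorphic U"
  proof -
    have "f ` U' = U"
      using fS \<open>U \<subseteq> T\<close> unfolding U'_def by blast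
    then have "homeomorphism U' U f g"
      by (intro homeomorphism_of_subsets[OF fg _ \<open>U \<subseteq> T\<close>]) (auto simp: U'_def)
    then show ?thesis
      unfolding homeomorphic_def by blast
  qed
  then have "U' homeomorphic (UNIV :: 'e set)"
    using U(3) by (rule homeomorphic_trans)
  then have "top_of_set U' homeomorphic_space top_of_set (UNIV :: 'e set)"
    by (simp only: homeomorphic_space_iff_homeomorphic)
  moreover have "top_of_set (UNIV :: 'e set) homeomorphic_space Euclidean_space DIM('e)"
    using homeomorphic_subspace_Euclidean_space_dim[of "UNIV :: 'e set"] by simp
  ultimately have "top_of_set U' homeomorphic_space Euclidean_space DIM('e)"
    by (rule homeomorphic_space_trans)
  moreover have "subtopology (top_of_set S) U' = top_of_set U'"
    by (simp add: subtopology_subtopology U'_def)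
  ultimately have "subtopology (top_of_set S) U' homeomorphic_space
      subtopology (Euclidean_space DIM('e)) (topspace (Euclidean_space DIM('e)))"
    by simp
  with \<open>openin (top_of_set S) U'\<close> \<open>x \<in> U'\<close>
  show "\<exists>U V. openin (top_of_set S) U \<and> x \<in> U \<and> openin (Euclidean_space DIM('e)) V \<and>
      subtopology (top_of_set S) U homeomorphic_space subtopology (Euclidean_space DIM('e)) V"
    by (intro exI[of _ U'] exI[of _ "topspace (Euclidean_space DIM('e))"] conjI openin_topspace)
qed

lemma sphere_torus_locally_euclidean:
  fixes x :: "'a::euclidean_space \<times> complex \<times> complex"
  assumes dim: "DIM('a) = DIM('b::euclidean_space) + 1"
    and x: "x \<in> sphere 0 1 \<times> sphere 0 1 \<times> sphere 0 1"
  shows "\<exists>U. openin (top_of_set (sphere 0 1 \<times> sphere 0 1 \<times> sphere 0 1)) U \<and> x \<in> U \<and>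
           U homeomorphic (UNIV :: ('b \<times> real \<times> real) set)"
proof -
  obtain u s t where [simp]: "x = (u, s, t)"
    by (cases x)
  obtain U where "openin (top_of_set (sphere 0 1)) U" "u \<in> U" "U homeomorphic (UNIV :: 'b set)"
    using sphere_locally_euclidean[OF dim, of u] x by auto
  moreover obtain V where "openin (top_of_set (sphere 0 1)) V" "s \<in> V" "V homeomorphic (UNIV :: real set)"
    using sphere_locally_euclidean[where 'b = real, of s] x by auto
  moreover obtain W where "openin (top_of_set (sphere 0 1)) W" "t \<in> W" "W homeomorphic (UNIV :: real set)"
    using sphere_locally_euclidean[where 'b = real, of t] x by auto
  ultimately show ?thesis
    using homeomorphic_product[of U "UNIV :: 'b set" "V \<times> W" "UNIV \<times> UNIV :: (real \<times> real) set"]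
      homeomorphic_product[of V "UNIV :: real set" W "UNIV :: real set"]
    by (intro exI[of _ "U \<times> V \<times> W"]) (auto simp: openin_Times)
qed

section \<open>The pairs of opposite vertices of the octahedron\<close>

lemma exhaust_6: "x = 0 \<or> x = 1 \<or> x = 2 \<or> x = 3 \<or> x = 4 \<or> x = 5" for x :: 6
proof (induct x)
  case (of_int z)
  then have "z = 0 \<or> z = 1 \<or> z = 2 \<or> z = 3 \<or> z = 4 \<or> z = 5"
    by fastforce
  then show ?case
    by auto
qed

lemma UNIV_6: "UNIV = {0, 1, 2, 3, 4, 5 :: 6}"
  using exhaust_6 by auto

lemma sum_6: "sum f (UNIV :: 6 set) = f 0 + f 1 + f 2 + f 3 + f 4 + f 5"
  unfolding UNIV_6 by (simp add: ac_simps)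

text \<open>
  The index \<open>j\<close> stands for the pair of antipodal vertices \<open>\<Lambda> 1 (partner j)\<close>, which carries the
  coordinate \<open>vertex j\<close>, and the vertex with the complementary labels, which carries the coordinate
  \<open>5 - vertex j\<close> because the labels are ordered lexicographically.
\<close>

definition vertex :: "3 \<Rightarrow> 6" where
  "vertex j = (if j = 1 then 0 else if j = 2 then 1 else 2)"

definition partner :: "3 \<Rightarrow> 4" where
  "partner j = (if j = 1 then 2 else if j = 2 then 3 else 4)"

lemma vertex_simps [simp]: "vertex 1 = 0" "vertex 2 = 1" "vertex 3 = 2"
  by (simp_all add: vertex_def)

lemma partner_simps [simp]: "partner 1 = 2" "partner 2 = 3" "partner 3 = 4"
  by (simp_all add: partner_def)

text \<open>
  Coordinates on the hyperplane of coordinate sum 2 centred at the midpoint of the octahedron, with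
  the long diagonals as axes: the octahedron becomes the unit ball of the 1-norm, and the inner walls
  \<open>q $ 1 + q $ i = 1\<close> become the coordinate planes.
\<close>

definition excess :: "real ^ 4 \<Rightarrow> 3 \<Rightarrow> real" where
  "excess q j = q $ 1 + q $ partner j - 1"

lemma moment_map_abs_cproj:
  assumes "z \<noteq> 0"
  shows "moment_map (abs_cproj z) =
    ((cmod (z $ 0))\<^sup>2 *\<^sub>R \<Lambda> 1 2 + (cmod (z $ 1))\<^sup>2 *\<^sub>R \<Lambda> 1 3 +
     (cmod (z $ 2))\<^sup>2 *\<^sub>R \<Lambda> 1 4 + (cmod (z $ 3))\<^sup>2 *\<^sub>R \<Lambda> 2 3 +
     (cmod (z $ 4))\<^sup>2 *\<^sub>R \<Lambda> 2 4 + (cmod (z $ 5))\<^sup>2 *\<^sub>R \<Lambda> 3 4) /\<^sub>R (norm z)\<^sup>2"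
  unfolding norm_complex_vec_squared
  by (rule moment_map.abs_eq) (rule proportional_refl[OF assms])

lemma moment_map_components:
  assumes "z \<noteq> 0"
  shows "moment_map (abs_cproj z) $ 1 = ((cmod (z $ 0))\<^sup>2 + (cmod (z $ 1))\<^sup>2 + (cmod (z $ 2))\<^sup>2) / (norm z)\<^sup>2"
    and "moment_map (abs_cproj z) $ 2 = ((cmod (z $ 0))\<^sup>2 + (cmod (z $ 3))\<^sup>2 + (cmod (z $ 4))\<^sup>2) / (norm z)\<^sup>2"
    and "moment_map (abs_cproj z) $ 3 = ((cmod (z $ 1))\<^sup>2 + (cmod (z $ 3))\<^sup>2 + (cmod (z $ 5))\<^sup>2) / (norm z)\<^sup>2"
    and "moment_map (abs_cproj z) $ 4 = ((cmod (z $ 2))\<^sup>2 + (cmod (z $ 4))\<^sup>2 + (cmod (z $ 5))\<^sup>2) / (norm z)\<^sup>2"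
  unfolding moment_map_abs_cproj[OF assms]
  by (simp_all add: \<Lambda>_def axis_def divide_inverse algebra_simps)

lemma sum_moment_map:
  assumes "z \<noteq> 0"
  shows "(\<Sum>i\<in>UNIV. moment_map (abs_cproj z) $ i) = 2"
proof -
  have "(\<Sum>i\<in>UNIV. moment_map (abs_cproj z) $ i) = 2 * (norm z)\<^sup>2 / (norm z)\<^sup>2"
    unfolding sum_4 moment_map_components[OF assms] add_divide_distrib[symmetric]
      norm_complex_vec_squared sum_6
    by (simp only: mult_2 ac_simps)
  then show ?thesis
    using assms by simp
qed

text \<open>
  The labels 1 and \<open>partner j\<close> together occur twice in \<open>vertex j\<close>, never in the antipodal vertex,
  and once in each of the other four, whose contributions cancel against the subtracted 1.
\<close>

lemma excess_moment_map:
  assumes "z \<noteq> 0"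
  shows "excess (moment_map (abs_cproj z)) j
     = ((cmod (z $ vertex j))\<^sup>2 - (cmod (z $ (5 - vertex j)))\<^sup>2) / (norm z)\<^sup>2"
proof -
  have one: "1 = (norm z)\<^sup>2 / (norm z)\<^sup>2"
    using assms by simp
  have "excess (moment_map (abs_cproj z)) j =
      ((norm z)\<^sup>2 * moment_map (abs_cproj z) $ 1 + (norm z)\<^sup>2 * moment_map (abs_cproj z) $ partner j
        - (norm z)\<^sup>2) / (norm z)\<^sup>2"
    using assms by (simp add: excess_def diff_divide_distrib add_divide_distrib)
  also have "(norm z)\<^sup>2 * moment_map (abs_cproj z) $ 1 + (norm z)\<^sup>2 * moment_map (abs_cproj z) $ partner j
      - (norm z)\<^sup>2 = (cmod (z $ vertex j))\<^sup>2 - (cmod (z $ (5 - vertex j)))\<^sup>2"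
  proof -
    consider "j = 1" | "j = 2" | "j = 3"
      using exhaust_3 by blast
    then show ?thesis
      by cases (use assms in \<open>simp_all add: moment_map_components norm_complex_vec_squared[symmetric]\<close>,
        simp_all add: norm_complex_vec_squared sum_6)
  qed
  finally show ?thesis .
qed

lemma eq_if_excess_eq:
  assumes "(\<Sum>i\<in>UNIV. p $ i) = (\<Sum>i\<in>UNIV. q $ i)" "\<And>j. excess p j = excess q j"
  shows "p = q"
  using assms(1) assms(2)[of 1] assms(2)[of 2] assms(2)[of 3]
  by (simp add: vec_eq_iff forall_4 sum_4 excess_def)

definition upper :: "(3 \<Rightarrow> real) \<Rightarrow> 3 \<Rightarrow> 6" where
  "upper e j = (if 0 < e j then vertex j else 5 - vertex j)"

definition lower :: "(3 \<Rightarrow> real) \<Rightarrow> 3 \<Rightarrow> 6" where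
  "lower e j = (if 0 < e j then 5 - vertex j else vertex j)"

lemma coordinate_pairing_octahedron: "coordinate_pairing (lower e) (upper e)"
proof
  have "inj vertex"
    by (simp add: inj_def forall_3)
  have opposite: "vertex i \<noteq> 5 - vertex j" for i j
  proof -
    have "\<forall>i j. vertex i \<noteq> 5 - vertex j"
      by (simp add: forall_3)
    then show ?thesis
      by blast
  qed
  show "inj (lower e)"
    using \<open>inj vertex\<close> opposite opposite[symmetric] by (auto simp: lower_def inj_def split: if_splits)
  show "inj (upper e)"
    using \<open>inj vertex\<close> opposite opposite[symmetric] by (auto simp: upper_def inj_def split: if_splits)
  show "lower e i \<noteq> upper e j" for i j
    using \<open>inj vertex\<close> opposite opposite[symmetric]
    by (cases "i = j") (auto simp: lower_def upper_def inj_def split: if_splits)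
  have pair: "vertex j \<in> range (lower e) \<union> range (upper e)" "5 - vertex j \<in> range (lower e) \<union> range (upper e)" for j
    unfolding Un_iff image_iff lower_def upper_def by (metis UNIV_I)+
  have "i \<in> range (lower e) \<union> range (upper e)" for i
    using exhaust_6[of i] pair[of 1] pair[of 2] pair[of 3] by auto
  then show "range (lower e) \<union> range (upper e) = UNIV"
    by blast
qed

lemma moment_fiber_eq_level_set:
  fixes Q
  defines "e \<equiv> excess Q"
  assumes "(\<Sum>i\<in>UNIV. Q $ i) = 2"
  shows "moment_map -` {Q}
    = abs_cproj ` coordinate_pairing.level_cone (lower e) (upper e) (\<lambda>j. \<bar>e j\<bar>)"
proof -
  interpret coordinate_pairing "lower e" "upper e"
    by (rule coordinate_pairing_octahedron)
  have key: "moment_map (abs_cproj z) = Q \<longleftrightarrow> z \<in> level_cone (\<lambda>j. \<bar>e j\<bar>)" if "z \<noteq> 0" for z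
  proof -
    have "moment_map (abs_cproj z) = Q \<longleftrightarrow> (\<forall>j. excess (moment_map (abs_cproj z)) j = e j)"
      using eq_if_excess_eq[of "moment_map (abs_cproj z)" Q] sum_moment_map[OF that] assms by auto
    also have "\<dots> \<longleftrightarrow> (\<forall>j. (cmod (z $ vertex j))\<^sup>2 - (cmod (z $ (5 - vertex j)))\<^sup>2 = e j * (norm z)\<^sup>2)"
      using that by (simp add: excess_moment_map divide_eq_eq)
    also have "\<dots> \<longleftrightarrow> (\<forall>j. (cmod (z $ upper e j))\<^sup>2 - (cmod (z $ lower e j))\<^sup>2 = \<bar>e j\<bar> * (norm z)\<^sup>2)"
      by (rule iff_allI) (auto simp: upper_def lower_def)
    finally show ?thesis
      using that by (simp add: level_cone_def)
  qed
  show ?thesis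
  proof (rule Set.set_eqI)
    fix p :: "6 cproj"
    obtain z where z: "z \<noteq> 0" "p = abs_cproj z"
      by (rule cproj_cases)
    show "p \<in> moment_map -` {Q} \<longleftrightarrow> p \<in> abs_cproj ` level_cone (\<lambda>j. \<bar>e j\<bar>)"
    proof
      assume "p \<in> moment_map -` {Q}"
      with key z show "p \<in> abs_cproj ` level_cone (\<lambda>j. \<bar>e j\<bar>)"
        by auto
    next
      assume "p \<in> abs_cproj ` level_cone (\<lambda>j. \<bar>e j\<bar>)"
      then obtain y where "y \<in> level_cone (\<lambda>j. \<bar>e j\<bar>)" "p = abs_cproj y"
        by blast
      moreover from this have "y \<noteq> 0"
        by (simp add: level_cone_def)
      ultimately show "p \<in> moment_map -` {Q}"
        using key by simp
    qed
  qed
qed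

section \<open>Regular values\<close>

definition weighted_ratio :: "('n \<Rightarrow> real) \<Rightarrow> complex ^ 'n::finite \<Rightarrow> real" where
  "weighted_ratio \<kappa> z = (\<Sum>i\<in>UNIV. \<kappa> i * (cmod (z $ i))\<^sup>2) / (norm z)\<^sup>2"

text \<open>
  Each term of the numerator is either absent or vanishes to second order at \<open>z\<close>.
\<close>

lemma weighted_ratio_has_derivative_zero:
  assumes "z \<noteq> 0" and vanish: "\<And>i. \<kappa> i = 0 \<or> z $ i = 0"
  shows "(weighted_ratio \<kappa> has_derivative (\<lambda>h. 0)) (at z)"
proof -
  have "((\<lambda>y. \<Sum>i\<in>UNIV. \<kappa> i * (y $ i \<bullet> y $ i)) has_derivative
      (\<lambda>h. \<Sum>i\<in>UNIV. \<kappa> i * (z $ i \<bullet> h $ i + h $ i \<bullet> z $ i))) (at z)"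
    by (intro has_derivative_sum has_derivative_mult_right has_derivative_inner
        bounded_linear.has_derivative[OF bounded_linear_vec_nth] has_derivative_ident)
  moreover have "\<kappa> i * (z $ i \<bullet> h $ i + h $ i \<bullet> z $ i) = 0" for i h
    using vanish[of i] by auto
  ultimately have num: "((\<lambda>y. \<Sum>i\<in>UNIV. \<kappa> i * (y $ i \<bullet> y $ i)) has_derivative (\<lambda>h. 0)) (at z)"
    by simp
  have den: "((\<lambda>y. y \<bullet> y) has_derivative (\<lambda>h. z \<bullet> h + h \<bullet> z)) (at z)"
    by (intro has_derivative_inner has_derivative_ident)
  have zero: "(\<Sum>i\<in>UNIV. \<kappa> i * (z $ i \<bullet> z $ i)) = 0"
    using vanish by (intro sum.neutral) auto
  have "((\<lambda>y. (\<Sum>i\<in>UNIV. \<kappa> i * (y $ i \<bullet> y $ i)) / (y \<bullet> y)) has_derivative (\<lambda>h. 0)) (at z)"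
    using has_derivative_divide'[OF num den] assms(1) by (simp add: zero)
  then show ?thesis
    unfolding weighted_ratio_def by (simp add: dot_square_norm)
qed

text \<open>
  The covector with coefficients \<open>\<epsilon>\<close> annihilates the image of the differential at \<open>z\<close>, because
  its composite with the moment map is, up to a constant, a ratio with vanishing derivative. At a
  regular value that image is the whole hyperplane direction, on which no other covector of this form vanishes.
\<close>

lemma regular_value_moment_map_conormal:
  assumes regular: "regular_value_moment_map Q"
    and z: "z \<noteq> 0" "moment_map (abs_cproj z) = Q"
    and ratio: "\<And>y. y \<noteq> 0 \<Longrightarrow>
      (\<Sum>j\<in>UNIV. \<epsilon> j * excess (moment_map (abs_cproj y)) j) = m + weighted_ratio \<kappa> y"
    and vanish: "\<And>i. \<kappa> i = 0 \<or> z $ i = 0"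
  shows "\<epsilon> j = 0"
proof -
  obtain D where D: "((moment_map \<circ> abs_cproj) has_derivative D) (at z)"
    and range_D: "range D = {v. (\<Sum>i\<in>UNIV. v $ i) = 0}"
    using regular z unfolding regular_value_moment_map_def by blast
  define L where "L v = (\<Sum>j\<in>UNIV. \<epsilon> j * (v $ 1 + v $ partner j))" for v :: "real ^ 4"
  have "bounded_linear L"
    unfolding L_def
    by (intro bounded_linear_sum bounded_linear_const_mult bounded_linear_add bounded_linear_vec_nth)
  then have "((\<lambda>y. L ((moment_map \<circ> abs_cproj) y)) has_derivative (\<lambda>h. L (D h))) (at z)"
    using D by (rule bounded_linear.has_derivative)
  moreover have "((\<lambda>y. L ((moment_map \<circ> abs_cproj) y)) has_derivative (\<lambda>h. 0)) (at z)"
  proof (rule has_derivative_transform_within_open)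
    show "((\<lambda>y. sum \<epsilon> UNIV + m + weighted_ratio \<kappa> y) has_derivative (\<lambda>h. 0)) (at z)"
      using has_derivative_add[OF has_derivative_const
          weighted_ratio_has_derivative_zero[of z \<kappa>, OF z(1) vanish]] by simp
    show "open (- {0 :: complex ^ 6})"
      by (simp add: open_Compl)
    show "z \<in> - {0}"
      using z by simp
    fix y :: "complex ^ 6"
    assume "y \<in> - {0}"
    then show "sum \<epsilon> UNIV + m + weighted_ratio \<kappa> y = L ((moment_map \<circ> abs_cproj) y)"
      using ratio[of y] by (simp add: L_def excess_def algebra_simps sum.distrib sum_subtractf)
  qed
  ultimately have "(\<lambda>h. L (D h)) = (\<lambda>h. 0)"
    by (rule has_derivative_unique)
  \<comment> \<open>The vector of coordinate sum 0 on which the functional takes the value \<open>\<Sum>j. (\<epsilon> j)\<^sup>2\<close>.\<close>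
  moreover define v :: "real ^ 4" where
    "v = (let t = (\<epsilon> 1 + \<epsilon> 2 + \<epsilon> 3) / 2
      in \<chi> i. if i = 1 then t else if i = 2 then \<epsilon> 1 - t else if i = 3 then \<epsilon> 2 - t else \<epsilon> 3 - t)"
  have v: "v $ 1 + v $ partner j = \<epsilon> j" for j
    using exhaust_3[of j] by (auto simp: v_def Let_def)
  have "v \<in> range D"
    unfolding range_D by (simp add: v_def Let_def sum_4 field_simps)
  ultimately have "L v = 0"
    by (metis rangeE)
  then have "(\<Sum>j\<in>UNIV. \<epsilon> j * \<epsilon> j) = 0"
    by (simp add: L_def v)
  then show ?thesis
    by (subst (asm) sum_nonneg_eq_0_iff) auto
qed

text \<open>
  Let \<open>s\<close> be the distance in the 1-norm from \<open>excess Q\<close> to the unit sphere. The point \<open>z k\<close> of the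
  level set spends all of \<open>s\<close> on the pair \<open>k\<close>, half on the squared modulus of each of its
  coordinates; in every other pair the small coordinate is zero. If \<open>excess Q j = 0\<close> and \<open>k \<noteq> j\<close>, both coordinates of the
  pair \<open>j\<close> vanish at \<open>z k\<close>, and the covector of the wall is not conormal at a regular value. If
  \<open>s = 0\<close>, all small coordinates vanish, and the covector of the facet through \<open>Q\<close> leads to the same
  contradiction.
\<close>

lemma regular_value_in_open_chamber:
  assumes Q: "Q \<in> hypersimplex" and regular: "regular_value_moment_map Q"
  shows "excess Q j \<noteq> 0" and "(\<Sum>j\<in>UNIV. \<bar>excess Q j\<bar>) < 1"
proof -
  define e where "e = excess Q"
  define s where "s = 1 - (\<Sum>j\<in>UNIV. \<bar>e j\<bar>)"
  interpret coordinate_pairing "lower e" "upper e"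
    by (rule coordinate_pairing_octahedron)
  have sum_Q: "(\<Sum>i\<in>UNIV. Q $ i) = 2"
    using Q by (simp add: hypersimplex_def)
  have "0 \<le> Q $ i" "Q $ i \<le> 1" for i
    using Q by (auto simp: hypersimplex_def)
  from this[of 1] this[of 2] this[of 3] this[of 4] have s: "0 \<le> s"
    using sum_Q unfolding s_def e_def excess_def sum_3 sum_4 by (simp add: abs_if)
  define z where "z k = assemble (\<lambda>j. \<bar>e j\<bar>) (axis k (of_real (sqrt (s / 2))), \<chi> j. 1)" for k
  have z_lower: "z k $ lower e j = (if j = k then of_real (sqrt (s / 2)) else 0)" for k j
    by (simp add: z_def axis_def)
  have z_upper: "z k $ upper e j = of_real (sqrt (\<bar>e j\<bar>))" if "j \<noteq> k" for k j
    using that by (simp add: z_def axis_def)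
  have z_level: "z k \<in> level_cone (\<lambda>j. \<bar>e j\<bar>)" for k
    unfolding z_def using s by (intro assemble_in_level_cone) (auto simp: norm_axis_squared s_def diff_divide_distrib)
  then have nonzero: "z k \<noteq> 0" for k
    by (auto simp: level_cone_def)
  have fiber: "moment_map (abs_cproj (z k)) = Q" for k
    using z_level moment_fiber_eq_level_set[OF sum_Q] by (auto simp: e_def)
  show "excess Q j \<noteq> 0"
  proof
    assume "excess Q j = 0"
    then have "e j = 0"
      by (simp add: e_def)
    obtain k where "j \<noteq> k"
      by (metis one_neq_zero)
    define \<kappa> :: "6 \<Rightarrow> real" where
      "\<kappa> i = (if i = vertex j then 1 else if i = 5 - vertex j then - 1 else 0)" for i
    define \<epsilon> :: "3 \<Rightarrow> real" where "\<epsilon> i = (if i = j then 1 else 0)" for i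
    have "\<epsilon> j = 0"
    proof (rule regular_value_moment_map_conormal[OF regular nonzero fiber])
      fix y :: "complex ^ 6"
      assume "y \<noteq> 0"
      then show "(\<Sum>i\<in>UNIV. \<epsilon> i * excess (moment_map (abs_cproj y)) i)
          = 0 + weighted_ratio \<kappa> y"
        using exhaust_3[of j]
        by (auto simp: excess_moment_map weighted_ratio_def \<epsilon>_def \<kappa>_def sum_6 sum_3)
    next
      show "\<kappa> i = 0 \<or> z k $ i = 0" for i
        using z_lower[of k j] z_upper[of j k] \<open>j \<noteq> k\<close> \<open>e j = 0\<close>
        by (auto simp: \<kappa>_def lower_def upper_def)
    qed
    then show False
      by (simp add: \<epsilon>_def)
  qed
  have "s \<noteq> 0"
  proof
    assume "s = 0"
    \<comment> \<open>The sum of \<open>\<epsilon> i\<close> times the excesses at \<open>y\<close> is the mass of the upper minus that of the lower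
      coordinates, relative to \<open>(norm y)\<^sup>2\<close>, and so is 1 minus twice the lower mass.\<close>
    define \<kappa> :: "6 \<Rightarrow> real" where "\<kappa> i = (if i \<in> range (lower e) then - 2 else 0)" for i
    have \<kappa>: "\<kappa> (lower e i) = - 2" "\<kappa> (upper e i) = 0" for i
      using disjoint by (auto simp: \<kappa>_def) (metis disjoint)
    define \<epsilon> :: "3 \<Rightarrow> real" where "\<epsilon> i = (if 0 < e i then 1 else - 1)" for i
    have "\<epsilon> 1 = 0"
    proof (rule regular_value_moment_map_conormal[OF regular nonzero fiber])
      fix y :: "complex ^ 6"
      assume y: "y \<noteq> 0"
      have "\<epsilon> i * excess (moment_map (abs_cproj y)) i
          = ((cmod (y $ upper e i))\<^sup>2 - (cmod (y $ lower e i))\<^sup>2) / (norm y)\<^sup>2" for i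
        using y by (simp add: excess_moment_map \<epsilon>_def upper_def lower_def minus_divide_left)
      then have "(\<Sum>i\<in>UNIV. \<epsilon> i * excess (moment_map (abs_cproj y)) i)
          = (\<Sum>i\<in>UNIV. (cmod (y $ upper e i))\<^sup>2 - (cmod (y $ lower e i))\<^sup>2) / (norm y)\<^sup>2"
        by (simp add: sum_divide_distrib)
      also have "(\<Sum>i\<in>UNIV. (cmod (y $ upper e i))\<^sup>2 - (cmod (y $ lower e i))\<^sup>2)
          = (norm y)\<^sup>2 + (\<Sum>i\<in>UNIV. \<kappa> i * (cmod (y $ i))\<^sup>2)"
        by (simp add: norm_complex_vec_squared sum_pairs \<kappa> flip: sum.distrib)
      finally show "(\<Sum>i\<in>UNIV. \<epsilon> i * excess (moment_map (abs_cproj y)) i)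
          = 1 + weighted_ratio \<kappa> y"
        using y by (simp add: weighted_ratio_def add_divide_distrib)
    next
      show "\<kappa> i = 0 \<or> z 1 $ i = 0" for i
        using \<open>s = 0\<close> z_lower by (auto simp: \<kappa>_def)
    qed
    then show False
      by (simp add: \<epsilon>_def split: if_splits)
  qed
  with s show "(\<Sum>j\<in>UNIV. \<bar>excess Q j\<bar>) < 1"
    by (simp add: s_def e_def)
qed

section \<open>The level set is a product of a sphere and a torus\<close>

lemma based_torus_homeomorphic:
  "based_torus (1 :: 3) homeomorphic (sphere (0 :: complex) 1 \<times> sphere (0 :: complex) 1)"
proof -
  have "homeomorphism (based_torus (1 :: 3)) (sphere (0 :: complex) 1 \<times> sphere (0 :: complex) 1)
      (\<lambda>\<tau>. (\<tau> $ 2, \<tau> $ 3)) (\<lambda>(s, t). \<chi> j. if j = 1 then 1 else if j = 2 then s else t)"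
  proof (rule homeomorphismI)
    have "continuous_on A (\<lambda>p. if j = 1 then 1 else if j = 2 then fst p else snd p)"
      for A :: "(complex \<times> complex) set" and j :: 3
      by (cases "j = 1"; cases "j = 2") (auto intro!: continuous_intros)
    then show "continuous_on (sphere 0 1 \<times> sphere 0 1)
        (\<lambda>(s :: complex, t). \<chi> j :: 3. if j = 1 then 1 else if j = 2 then s else t)"
      unfolding case_prod_beta by (intro continuous_on_vec_lambda)
  qed (auto simp: based_torus_def vec_eq_iff forall_3 intro!: continuous_intros)
  then show ?thesis
    unfolding homeomorphic_def by blast
qed

theorem theorem3:
  fixes Q :: "real ^ 4"
  assumes "Q \<in> hypersimplex" and "regular_value_moment_map Q"
  shows "topological_manifold 7 (top_of_set (moment_map -` {Q}))
     \<and> (moment_map -` {Q}) homeomorphic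
         (sphere (0 :: real ^ 6) 1 \<times> (sphere (0 :: complex) 1 \<times> sphere (0 :: complex) 1))"
proof -
  define e where "e = excess Q"
  define r where "r = sqrt ((1 - (\<Sum>j\<in>UNIV. \<bar>e j\<bar>)) / 2)"
  interpret coordinate_pairing "lower e" "upper e"
    by (rule coordinate_pairing_octahedron)
  have e: "0 < \<bar>e j\<bar>" "(\<Sum>j\<in>UNIV. \<bar>e j\<bar>) < 1" for j
    using regular_value_in_open_chamber[OF assms] by (auto simp: e_def)
  have "moment_map -` {Q} = abs_cproj ` level_cone (\<lambda>j. \<bar>e j\<bar>)"
    using moment_fiber_eq_level_set[of Q] assms(1) by (simp add: hypersimplex_def e_def)
  also have "\<dots> homeomorphic sphere (0 :: complex ^ 3) r \<times> based_torus (1 :: 3)"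
    unfolding r_def using level_set_homeomorphic_sphere_torus[of "\<lambda>j. \<bar>e j\<bar>" 1] e by simp
  also have "\<dots> homeomorphic sphere (0 :: real ^ 6) 1 \<times> (sphere (0 :: complex) 1 \<times> sphere (0 :: complex) 1)"
    using e by (intro homeomorphic_product homeomorphic_spheres_gen based_torus_homeomorphic)
      (auto simp: r_def)
  finally have homeo: "moment_map -` {Q} homeomorphic
      sphere (0 :: real ^ 6) 1 \<times> (sphere (0 :: complex) 1 \<times> sphere (0 :: complex) 1)" .
  have "topological_manifold DIM((real ^ 5) \<times> real \<times> real) (top_of_set (moment_map -` {Q}))"
    by (rule topological_manifold_if_homeomorphic[OF homeo], rule sphere_torus_locally_euclidean) auto
  then show ?thesis
    using homeo by simp
qed

end
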